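(* Let $\mathbf t=(t_0,u_0,t_1,u_1)\in\mathbb C^4$ be generic (in the sense specified in the context) and $\mathbf t^\sigma=(u_1,u_0,t_1,t_0)$. For $m,n\in\mathbb Z_{\ge0}$ and $p\in\mathcal A=\mathbb C[x]$ we have $$p(-\gamma_m)=\widetilde B\big(p(z),E(z,\gamma_m;\mathbf t)\big),\qquad p(-x_n)=B\big(p(z),E(z,x_n;\mathbf t^\sigma)\big).$$ Consequently, the non-symmetric Wilson polynomials satisfy the duality property $$E(-x_n,\gamma_m;\mathbf t)=E(-\gamma_m,x_n;\mathbf t^\sigma).$$
   Context: $\mathbb N=\{1,2,\dots\}$. For $\mathbf t=(t_0,u_0,t_1,u_1)$ define operators $T_i=T_i(\mathbf t)$ on $\mathcal A$ by $$(T_0f)(x)=t_0f(x)+\frac{(t_0+u_0+\frac12-x)(t_0-u_0+\frac12-x)}{1-2x}\big(f(1-x)-f(x)\big),$$ $$(T_1f)(x)=t_1f(x)+\frac{(t_1+u_1+x)(t_1-u_1+x)}{2x}\big(f(-x)-f(x)\big),$$ $Y=Y(\mathbf t)=T_0+T_1$, and $z$ = multiplication by $x$. $\mathcal H=\mathcal H(\mathbf t)\subset\mathrm{End}(\mathcal A)$ is the unital subalgebra generated by $T_0,T_1,z$; $\mathcal H_\sigma=\mathcal H(\mathbf t^\sigma)$, $T_i^\sigma=T_i(\mathbf t^\sigma)$. Generic means, with $(a,b,c,d)=(t_1+u_1,t_1-u_1,t_0+u_0+\frac12,t_0-u_0+\frac12)$: $t_0,t_1\ne0$; $t_0+t_1\notin-\frac12\mathbb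 N$; $a,b,c,d\notin-\frac12\mathbb Z_{\ge0}$; no sum of two of $a,b,c,d$ (at distinct positions) lies in $\mathbb Z$. Spectra: $\gamma_{2n}=t_0+t_1+n$ ($n\ge0$), $\gamma_{2n-1}=-(t_0+t_1+n)$ ($n\ge1$); $x_{2n}=t_1+u_1+n$ ($n\ge0$), $x_{2n-1}=-(t_1+u_1+n)$ ($n\ge1$) (so $x_m$ is $\gamma_m$ with $\mathbf t$ replaced by $\mathbf t^\sigma$; and $x_0=t_1+u_1$). The non-symmetric Wilson polynomial $p_m(\cdot;\mathbf t)$ is the unique monic polynomial of degree $m$ with $Y(\mathbf t)p_m=\gamma_mp_m$. Renormalized: $E(x,\gamma_m;\mathbf t)=p_m(x;\mathbf t)/p_m(-x_0;\mathbf t)$, and correspondingly $E(x,x_n;\mathbf t^\sigma)=p_n(x;\mathbf t^\sigma)/p_n(-\gamma_0;\mathbf t^\sigma)$. $\psi:\mathcal H\to\mathcal H_\sigma$ is the algebra anti-isomorphism with $T_0\mapsto-(T_1^\sigma+z)$, $T_1\mapsto T_1^\sigma$, $z\mapsto-(T_0^\sigma+T_1^\sigma)$; its inverse is $\psi_\sigma:\mathcal H_\sigma\to\mathcal H$, $T_0^\sigma\mapsto-(T_1+z)$, $T_1^\sigma\mapsto T_1$, $z\mapsto-(T_0+T_1)$. Evaluation maps (with $1\in\mathcal A$ the constant polynomial): $\mathrm{Ev}(X)=(X(1))(-x_0)$ for $X\in\mathcal H$; $\widetilde{\mathrm{Ev}}(\widetilde X)=(\widetilde X(1))(-\gamma_0)$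 for $\widetilde X\in\mathcal H_\sigma$. Pairings: $B:\mathcal H\times\mathcal H_\sigma\to\mathbb C$, $B(X,\widetilde X)=\mathrm{Ev}(\psi_\sigma(\widetilde X)X)$, and $\widetilde B:\mathcal H_\sigma\times\mathcal H\to\mathbb C$, $\widetilde B(\widetilde X,X)=\widetilde{\mathrm{Ev}}(\psi(X)\widetilde X)$. For a polynomial $q$, $q(z)$ is the operator of multiplication by $q$, an element of both $\mathcal H$ and $\mathcal H_\sigma$. *)

theory Defs
  imports Complex_Main "HOL-Library.FuncSet" "HOL-Computational_Algebra.Polynomial"
begin

text \<open>Parameters are 4-tuples \<open>(t\<^sub>0, u\<^sub>0, t\<^sub>1, u\<^sub>1)\<close>.\<close>

type_synonym params = "complex \<times> complex \<times> complex \<times> complex"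

type_synonym poly_op = "complex poly \<Rightarrow> complex poly"

fun sigma :: "params \<Rightarrow> params" where
  "sigma (t0, u0, t1, u1) = (u1, u0, t1, t0)"

fun generic :: "params \<Rightarrow> bool" where
  "generic (t0, u0, t1, u1) \<longleftrightarrow>
     (let abcd = [t1 + u1, t1 - u1, t0 + u0 + 1/2, t0 - u0 + 1/2] in
        t0 \<noteq> 0 \<and> t1 \<noteq> 0 \<and>
        (\<forall>k::nat. k \<ge> 1 \<longrightarrow> t0 + t1 \<noteq> - (of_nat k / 2)) \<and>
        (\<forall>v \<in> set abcd. \<forall>k::nat. v \<noteq> - (of_nat k / 2)) \<and>
        (\<forall>i j. i < j \<and> j < 4 \<longrightarrow> abcd ! i + abcd ! j \<notin> \<int>))"

text \<open>
  The polynomial divisions \<open>div\<close> below are exact, because \<open>f(1 - x) - f(x)\<close> vanishes at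
  \<open>x = 1/2\<close> and \<open>f(-x) - f(x)\<close> at \<open>x = 0\<close>; see the lemmas \<open>poly_T0\<close> and \<open>poly_T1\<close>.
\<close>

fun T0 :: "params \<Rightarrow> poly_op" where
  "T0 (t0, u0, t1, u1) f =
     smult t0 f + [:t0 + u0 + 1/2, -1:] * [:t0 - u0 + 1/2, -1:]
                    * ((pcompose f [:1, -1:] - f) div [:1, -2:])"

fun T1 :: "params \<Rightarrow> poly_op" where
  "T1 (t0, u0, t1, u1) f =
     smult t1 f + [:t1 + u1, 1:] * [:t1 - u1, 1:]
                    * ((pcompose f [:0, -1:] - f) div [:0, 2:])"

lemma poly_div_linear:
  fixes h :: "complex poly"
  assumes "b \<noteq> 0" and "poly h (- a / b) = 0" and "a + b * x \<noteq> 0"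
  shows "poly (h div [:a, b:]) x = poly h x / (a + b * x)"
proof -
  have "[:a, b:] = smult b [:- (- a / b), 1:]"
    using assms(1) by simp
  moreover have "[:- (- a / b), 1:] dvd h"
    using assms(2) by (simp only: poly_eq_0_iff_dvd)
  ultimately have "[:a, b:] dvd h"
    using assms(1) by (metis smult_dvd_iff)
  then have "h = [:a, b:] * (h div [:a, b:])"
    by (metis dvd_mult_div_cancel)
  then have "poly h x = poly [:a, b:] x * poly (h div [:a, b:]) x"
    by (metis poly_mult)
  then show ?thesis
    using assms(3) by (simp add: field_simps)
qed

lemma poly_T0:
  assumes "x \<noteq> 1/2"
  shows "poly (T0 (t0, u0, t1, u1) f) x =
           t0 * poly f x + (t0 + u0 + 1/2 - x) * (t0 - u0 + 1/2 - x) / (1 - 2 * x)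
                             * (poly f (1 - x) - poly f x)"
proof -
  have "1 + (-2) * x \<noteq> 0"
    using assms by (auto simp: field_simps)
  then have "poly ((pcompose f [:1, -1:] - f) div [:1, -2:]) x =
      poly (pcompose f [:1, -1:] - f) x / (1 + (-2) * x)"
    by (intro poly_div_linear) (auto simp: poly_pcompose)
  moreover have "poly [:t0 + u0 + 1/2, -1:] x = t0 + u0 + 1/2 - x"
    and "poly [:t0 - u0 + 1/2, -1:] x = t0 - u0 + 1/2 - x"
    and "poly [:1, -1:] x = 1 - x" and "1 + (-2) * x = 1 - 2 * x"
    by simp_all
  ultimately show ?thesis
    by (simp only: T0.simps poly_add poly_diff poly_smult poly_mult poly_pcompose
        times_divide_eq_left times_divide_eq_right)
qed

lemma poly_T1:
  assumes "x \<noteq> 0"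
  shows "poly (T1 (t0, u0, t1, u1) f) x =
           t1 * poly f x + (t1 + u1 + x) * (t1 - u1 + x) / (2 * x)
                             * (poly f (- x) - poly f x)"
proof -
  have "0 + 2 * x \<noteq> 0"
    using assms by simp
  then have "poly ((pcompose f [:0, -1:] - f) div [:0, 2:]) x =
      poly (pcompose f [:0, -1:] - f) x / (0 + 2 * x)"
    by (intro poly_div_linear) (auto simp: poly_pcompose)
  moreover have "poly [:t1 + u1, 1:] x = t1 + u1 + x"
    and "poly [:t1 - u1, 1:] x = t1 - u1 + x"
    and "poly [:0, -1:] x = - x" and "0 + 2 * x = 2 * x"
    by simp_all
  ultimately show ?thesis
    by (simp only: T1.simps poly_add poly_diff poly_smult poly_mult poly_pcompose
        times_divide_eq_left times_divide_eq_right)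
qed

definition Y :: "params \<Rightarrow> poly_op" where
  "Y t = (\<lambda>f. T0 t f + T1 t f)"

definition mult_op :: "complex poly \<Rightarrow> poly_op" where
  "mult_op q = (\<lambda>f. q * f)"

definition z_op :: poly_op where
  "z_op = mult_op [:0, 1:]"

inductive_set H :: "params \<Rightarrow> poly_op set" for t :: params where
  T0: "T0 t \<in> H t"
| T1: "T1 t \<in> H t"
| z: "z_op \<in> H t"
| one: "id \<in> H t"
| add: "X \<in> H t \<Longrightarrow> X' \<in> H t \<Longrightarrow> (\<lambda>f. X f + X' f) \<in> H t"
| scale: "X \<in> H t \<Longrightarrow> (\<lambda>f. smult c (X f)) \<in> H t"
| comp: "X \<in> H t \<Longrightarrow> X' \<in> H t \<Longrightarrow> X \<circ> X' \<in> H t"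

definition alg_anti_iso :: "params \<Rightarrow> params \<Rightarrow> (poly_op \<Rightarrow> poly_op) \<Rightarrow> bool" where
  "alg_anti_iso s t \<phi> \<longleftrightarrow>
     bij_betw \<phi> (H s) (H t) \<and>
     \<phi> id = id \<and>
     (\<forall>X \<in> H s. \<forall>X' \<in> H s. \<phi> (\<lambda>f. X f + X' f) = (\<lambda>f. \<phi> X f + \<phi> X' f)) \<and>
     (\<forall>c. \<forall>X \<in> H s. \<phi> (\<lambda>f. smult c (X f)) = (\<lambda>f. smult c (\<phi> X f))) \<and>
     (\<forall>X \<in> H s. \<forall>X' \<in> H s. \<phi> (X \<circ> X') = \<phi> X' \<circ> \<phi> X)"

text \<open>
  Only the restriction of \<open>\<psi>\<close> to \<open>H t\<close> is meaningful; \<open>extensional\<close> fixes its values elsewhere,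
  so that the definite description can denote.
\<close>

definition psi :: "params \<Rightarrow> poly_op \<Rightarrow> poly_op" where
  "psi t = (THE \<phi>. \<phi> \<in> extensional (H t) \<and> alg_anti_iso t (sigma t) \<phi> \<and>
     \<phi> (T0 t) = (\<lambda>f. - (T1 (sigma t) f + z_op f)) \<and>
     \<phi> (T1 t) = T1 (sigma t) \<and>
     \<phi> z_op = (\<lambda>f. - (T0 (sigma t) f + T1 (sigma t) f)))"

definition psi_sigma :: "params \<Rightarrow> poly_op \<Rightarrow> poly_op" where
  "psi_sigma t = the_inv_into (H t) (psi t)"

fun gamma :: "params \<Rightarrow> nat \<Rightarrow> complex" where
  "gamma (t0, u0, t1, u1) m =
     (if even m then t0 + t1 + of_nat (m div 2) else - (t0 + t1 + of_nat ((m + 1) div 2)))"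

fun xspec :: "params \<Rightarrow> nat \<Rightarrow> complex" where
  "xspec (t0, u0, t1, u1) m =
     (if even m then t1 + u1 + of_nat (m div 2) else - (t1 + u1 + of_nat ((m + 1) div 2)))"

lemma xspec_eq_gamma_sigma: "xspec t m = gamma (sigma t) m"
  by (cases t) (simp add: add.commute)

definition wilson_poly :: "params \<Rightarrow> nat \<Rightarrow> complex poly" where
  "wilson_poly t m =
     (THE p. lead_coeff p = 1 \<and> degree p = m \<and> Y t p = smult (gamma t m) p)"

text \<open>
  \<open>E t m\<close> is the polynomial \<open>E(\<cdot>, \<gamma>\<^sub>m; t)\<close>. Hence \<open>E (sigma t) n\<close> is \<open>E(\<cdot>, x\<^sub>n; t\<^sup>\<sigma>)\<close>, with
  normalization point \<open>- xspec (sigma t) 0 = - gamma t 0\<close>.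
\<close>

definition E :: "params \<Rightarrow> nat \<Rightarrow> complex poly" where
  "E t m = smult (1 / poly (wilson_poly t m) (- xspec t 0)) (wilson_poly t m)"

definition Ev :: "params \<Rightarrow> poly_op \<Rightarrow> complex" where
  "Ev t X = poly (X 1) (- xspec t 0)"

definition Ev_tilde :: "params \<Rightarrow> poly_op \<Rightarrow> complex" where
  "Ev_tilde t X = poly (X 1) (- gamma t 0)"

definition B :: "params \<Rightarrow> poly_op \<Rightarrow> poly_op \<Rightarrow> complex" where
  "B t X X' = Ev t (psi_sigma t X' \<circ> X)"

definition B_tilde :: "params \<Rightarrow> poly_op \<Rightarrow> poly_op \<Rightarrow> complex" where
  "B_tilde t X' X = Ev_tilde t (psi t X \<circ> X')"

end

(*
Put S = -(T1 + z). The elements T1 and S satisfy quadratic relations that make T1 - a map the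
g-eigenspace of Y to the (-g)-eigenspace and S - b map it to the (-g-1)-eigenspace, for suitable
scalars a, b. Starting from the constant 1, these intertwiners produce all the polynomials p_m;
as T1 and S act by scalars under evaluation at -x_0, they also yield p_m(-x_0) <> 0 and give the
action of T1 and S on the E(., gamma_m) with explicit coefficients. These coefficients coincide
with those of the action of T1 and T0 at the points of the dual spectrum, where
-x_n and x_n, and -x_n and 1 + x_n, are neighbours. Hence for the bilinear form on polynomials
determined by <p, E(., x_n; t^sigma)> = p(-x_n), the adjoints of T0, T1, z are -(T1^sigma + z),
T1^sigma, -Y^sigma. The form is nondegenerate and satisfies <E(., gamma_m; t), q> = q(-gamma_m), so
taking adjoints is a well-defined anti-isomorphism, which is psi; no presentation of the algebra
by generators and relations is needed. The evaluation formulas and the duality follow by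
moving multiplication operators from one side of the form to the other.
*)

theory Submission
  imports Defs
begin

declare T0.simps [simp del] T1.simps [simp del]

section \<open>Comparison of polynomials at points, and linearity of the operators\<close>

lemma poly_eqI_infinite:
  fixes p q :: "complex poly"
  assumes "infinite A" and "\<And>x. x \<in> A \<Longrightarrow> poly p x = poly q x"
  shows "p = q"
proof (rule ccontr)
  assume "p \<noteq> q"
  then have "finite {x. poly (p - q) x = 0}"
    by (intro poly_roots_finite) simp
  moreover have "A \<subseteq> {x. poly (p - q) x = 0}"
    using assms(2) by auto
  ultimately show False
    using assms(1) finite_subset by blast
qed

text \<open>The formulas \<open>poly_T0\<close> and \<open>poly_T1\<close> exclude one point each;
  identities between the operators are therefore checked away from it.\<close>

lemma poly_eqI_cofinite:
  fixes p q :: "complex poly"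
  assumes "finite A" and "\<And>x. x \<notin> A \<Longrightarrow> poly p x = poly q x"
  shows "p = q"
  using assms infinite_UNIV_char_0[where 'a = complex]
  by (intro poly_eqI_infinite[of "- A"]) (simp_all add: Compl_eq_Diff_UNIV)

lemma T0_add: "T0 t (f + g) = T0 t f + T0 t g"
  by (cases t, rule poly_eqI_cofinite[of "{1/2}"])
    (auto simp: poly_T0 algebra_simps add_divide_distrib diff_divide_distrib)

lemma T1_add: "T1 t (f + g) = T1 t f + T1 t g"
  by (cases t, rule poly_eqI_cofinite[of "{0}"])
    (auto simp: poly_T1 algebra_simps add_divide_distrib diff_divide_distrib)

lemma T0_smult: "T0 t (smult c f) = smult c (T0 t f)"
  by (cases t, rule poly_eqI_cofinite[of "{1/2}"])
    (auto simp: poly_T0 algebra_simps add_divide_distrib diff_divide_distrib)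

lemma T1_smult: "T1 t (smult c f) = smult c (T1 t f)"
  by (cases t, rule poly_eqI_cofinite[of "{0}"])
    (auto simp: poly_T1 algebra_simps add_divide_distrib diff_divide_distrib)

lemma T0_uminus: "T0 t (- f) = - T0 t f"
  using T0_smult[of t "-1" f] by simp

lemma T1_uminus: "T1 t (- f) = - T1 t f"
  using T1_smult[of t "-1" f] by simp

lemma Y_add: "Y t (f + g) = Y t f + Y t g"
  by (simp add: Y_def T0_add T1_add)

lemma Y_smult: "Y t (smult c f) = smult c (Y t f)"
  by (simp add: Y_def T0_smult T1_smult smult_add_right)

lemma Y_uminus: "Y t (- f) = - Y t f"
  by (simp add: Y_def T0_uminus T1_uminus)

lemma Y_diff: "Y t (f - g) = Y t f - Y t g"
  using Y_add[of t f "- g"] by (simp add: Y_uminus)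

section \<open>Relations between \<open>T0\<close>, \<open>T1\<close>, \<open>Y\<close>,
  \<open>S\<close> and multiplication by \<open>x\<close>\<close>

text \<open>With \<open>C\<close> the coefficient of the difference term, \<open>T1\<close> maps
  \<open>f\<close> to \<open>(t1 - C) f + C f(- x)\<close>. The square is a scalar because
  \<open>C x + C (- x) = 2 * t1\<close>.\<close>

lemma T1_T1: "T1 (t0, u0, t1, u1) (T1 (t0, u0, t1, u1) f) = smult (t1\<^sup>2) f"
proof (rule poly_eqI_cofinite[of "{0}"])
  fix x :: complex
  assume "x \<notin> {0}"
  then have x: "x \<noteq> 0" "- x \<noteq> 0" by auto
  define C where "C = (\<lambda>x. (t1 + u1 + x) * (t1 - u1 + x) / (2 * x))"
  have C: "C (- x) = 2 * t1 - C x"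
    using x by (simp add: C_def field_simps)
  have *: "poly (T1 (t0, u0, t1, u1) g) y = t1 * poly g y + C y * (poly g (- y) - poly g y)"
    if "y \<noteq> 0" for g y
    using that by (simp add: poly_T1 C_def)
  show "poly (T1 (t0, u0, t1, u1) (T1 (t0, u0, t1, u1) f)) x = poly (smult (t1\<^sup>2) f) x"
    using x by (simp add: * C) (simp add: algebra_simps power2_eq_square)
qed simp

text \<open>As for \<open>T1_T1\<close>, with the reflection of \<open>x\<close> to
  \<open>1 - x\<close>, for which \<open>C x + C (1 - x) = 2 * t0\<close>.\<close>

lemma T0_T0: "T0 (t0, u0, t1, u1) (T0 (t0, u0, t1, u1) f) = smult (t0\<^sup>2) f"
proof (rule poly_eqI_cofinite[of "{1/2}"])
  fix x :: complex
  assume "x \<notin> {1/2}"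
  then have x: "x \<noteq> 1/2" "1 - x \<noteq> 1/2" "1 - 2 * x \<noteq> 0" "2 * x - 1 \<noteq> 0"
    by (auto simp: field_simps)
  define C where "C = (\<lambda>x. (t0 + u0 + 1/2 - x) * (t0 - u0 + 1/2 - x) / (1 - 2 * x))"
  have "1 - 2 * (1 - x) = - (1 - 2 * x)"
    by simp
  then have "C (1 - x) = - ((t0 + u0 - 1/2 + x) * (t0 - u0 - 1/2 + x) / (1 - 2 * x))"
    unfolding C_def by (simp only: divide_minus_right) (simp add: algebra_simps)
  then have "C (1 - x) + C x = ((t0 + u0 + 1/2 - x) * (t0 - u0 + 1/2 - x)
      - (t0 + u0 - 1/2 + x) * (t0 - u0 - 1/2 + x)) / (1 - 2 * x)"
    by (simp add: C_def diff_divide_distrib)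
  also have "(t0 + u0 + 1/2 - x) * (t0 - u0 + 1/2 - x)
      - (t0 + u0 - 1/2 + x) * (t0 - u0 - 1/2 + x) = 2 * t0 * (1 - 2 * x)"
    by (simp add: field_simps)
  finally have "C (1 - x) + C x = 2 * t0"
    using x by simp
  then have C: "C (1 - x) = 2 * t0 - C x"
    by (simp add: algebra_simps)
  have *: "poly (T0 (t0, u0, t1, u1) g) y = t0 * poly g y + C y * (poly g (1 - y) - poly g y)"
    if "y \<noteq> 1/2" for g y
    using that by (simp add: poly_T0 C_def)
  show "poly (T0 (t0, u0, t1, u1) (T0 (t0, u0, t1, u1) f)) x = poly (smult (t0\<^sup>2) f) x"
    using x by (simp add: * C) (simp add: algebra_simps power2_eq_square)
qed simp

text \<open>In \<open>T1 z + z T1\<close> the reflected terms cancel and multiplication by the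
  polynomial \<open>2 * x * (t1 - C)\<close> remains. Together with \<open>T1_T1\<close> the
  relation says \<open>(T1 + z)^2 = u1^2\<close>.\<close>

lemma T1_z:
  "T1 (t0, u0, t1, u1) (pCons 0 f) =
     - pCons 0 (T1 (t0, u0, t1, u1) f) - pCons 0 (pCons 0 f) - smult (t1\<^sup>2 - u1\<^sup>2) f"
proof (rule poly_eqI_cofinite[of "{0}"])
  fix x :: complex
  assume "x \<notin> {0}"
  then have x: "x \<noteq> 0" by auto
  define C where "C = (t1 + u1 + x) * (t1 - u1 + x) / (2 * x)"
  have C: "2 * x * C = (t1 + x)\<^sup>2 - u1\<^sup>2"
    using x by (simp add: C_def) (simp add: algebra_simps power2_eq_square)
  have *: "poly (T1 (t0, u0, t1, u1) g) x = t1 * poly g x + C * (poly g (- x) - poly g x)" for g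
    using x by (simp add: poly_T1 C_def)
  have "poly (T1 (t0, u0, t1, u1) (pCons 0 f)) x + x * poly (T1 (t0, u0, t1, u1) f) x =
      2 * t1 * x * poly f x - (2 * x * C) * poly f x"
    by (simp add: *) (simp add: algebra_simps)
  also have "\<dots> = - x * (x * poly f x) - (t1\<^sup>2 - u1\<^sup>2) * poly f x"
    unfolding C by (simp add: algebra_simps power2_eq_square)
  finally show "poly (T1 (t0, u0, t1, u1) (pCons 0 f)) x = poly (- pCons 0 (T1 (t0, u0, t1, u1) f)
      - pCons 0 (pCons 0 f) - smult (t1\<^sup>2 - u1\<^sup>2) f) x"
    by (simp add: algebra_simps)
qed simp

text \<open>Here the reflected terms cancel in \<open>T0 z + z T0 - T0\<close>. Together with
  \<open>T0_T0\<close> the relation says \<open>(T0 - z + 1/2)^2 = u0^2\<close>.\<close>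

lemma T0_z:
  "T0 (t0, u0, t1, u1) (pCons 0 f) =
     - pCons 0 (T0 (t0, u0, t1, u1) f) + T0 (t0, u0, t1, u1) f + pCons 0 (pCons 0 f) - pCons 0 f
       + smult (t0\<^sup>2 - u0\<^sup>2 + 1/4) f"
proof (rule poly_eqI_cofinite[of "{1/2}"])
  fix x :: complex
  assume "x \<notin> {1/2}"
  then have x: "x \<noteq> 1/2" "1 - 2 * x \<noteq> 0" by (auto simp: field_simps)
  define C where "C = (t0 + u0 + 1/2 - x) * (t0 - u0 + 1/2 - x) / (1 - 2 * x)"
  have C: "(1 - 2 * x) * C = (t0 + 1/2 - x)\<^sup>2 - u0\<^sup>2"
    using x(2) by (simp add: C_def) (simp add: algebra_simps power2_eq_square)
  have *: "poly (T0 (t0, u0, t1, u1) g) x = t0 * poly g x + C * (poly g (1 - x) - poly g x)" for g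
    using x by (simp add: poly_T0 C_def)
  have "poly (T0 (t0, u0, t1, u1) (pCons 0 f)) x + (x - 1) * poly (T0 (t0, u0, t1, u1) f) x =
      (2 * x - 1) * t0 * poly f x + ((1 - 2 * x) * C) * poly f x"
    by (simp add: *) (simp add: algebra_simps)
  also have "\<dots> = (x * x - x + (t0\<^sup>2 - u0\<^sup>2 + 1/4)) * poly f x"
    unfolding C by (simp add: algebra_simps power2_eq_square)
  finally show "poly (T0 (t0, u0, t1, u1) (pCons 0 f)) x = poly (- pCons 0 (T0 (t0, u0, t1, u1) f)
      + T0 (t0, u0, t1, u1) f + pCons 0 (pCons 0 f) - pCons 0 f
       + smult (t0\<^sup>2 - u0\<^sup>2 + 1/4) f) x"
    by (simp add: algebra_simps)
qed simp

text \<open>This is \<open>T0^2 = t0^2\<close> with \<open>T0\<close> written as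
  \<open>Y - T1\<close>.\<close>

lemma T1_Y:
  "T1 (t0, u0, t1, u1) (Y (t0, u0, t1, u1) f) + Y (t0, u0, t1, u1) (T1 (t0, u0, t1, u1) f) =
     Y (t0, u0, t1, u1) (Y (t0, u0, t1, u1) f) + smult (t1\<^sup>2 - t0\<^sup>2) f"
  by (simp add: Y_def T0_add T1_add T0_T0 T1_T1 smult_diff_left)

lemma Y_z:
  "Y (t0, u0, t1, u1) (pCons 0 f) = - pCons 0 (Y (t0, u0, t1, u1) f) + T0 (t0, u0, t1, u1) f
     - pCons 0 f + smult (t0\<^sup>2 - u0\<^sup>2 + 1/4 - t1\<^sup>2 + u1\<^sup>2) f"
proof -
  have "smult (t0\<^sup>2 - u0\<^sup>2 + 1/4 - t1\<^sup>2 + u1\<^sup>2) f =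
      smult (t0\<^sup>2 - u0\<^sup>2 + 1/4) f - smult (t1\<^sup>2 - u1\<^sup>2) f"
    by (simp only: smult_diff_left[symmetric]) (simp add: algebra_simps)
  moreover have "pCons 0 (T0 (t0, u0, t1, u1) f + T1 (t0, u0, t1, u1) f) =
      pCons 0 (T0 (t0, u0, t1, u1) f) + pCons 0 (T1 (t0, u0, t1, u1) f)"
    by simp
  ultimately show ?thesis
    unfolding Y_def T0_z T1_z by (simp add: algebra_simps del: minus_pCons diff_pCons add_pCons)
qed

text \<open>\<open>S t\<close> is the image of \<open>T0 (sigma t)\<close> under \<open>\<psi>\<^sub>\<sigma>\<close>; its square is the scalar \<open>u1\<^sup>2\<close>.\<close>

definition S :: "params \<Rightarrow> poly_op" where
  "S t f = - (T1 t f + pCons 0 f)"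

lemma S_smult: "S t (smult c f) = smult c (S t f)"
  by (simp only: S_def T1_smult smult_minus_right smult_add_right smult_pCons mult_zero_right)

text \<open>Given \<open>S^2 = u1^2\<close>, this is \<open>(S + Y + 1/2)^2 = u0^2\<close>
  multiplied out, since \<open>T0 - z + 1/2 = S + Y + 1/2\<close>.\<close>

lemma S_Y:
  "S (t0, u0, t1, u1) (Y (t0, u0, t1, u1) f) + Y (t0, u0, t1, u1) (S (t0, u0, t1, u1) f) =
     smult (u0\<^sup>2 - u1\<^sup>2 - 1/4) f - Y (t0, u0, t1, u1) (Y (t0, u0, t1, u1) f)
       - Y (t0, u0, t1, u1) f - S (t0, u0, t1, u1) f" (is "?L = _")
proof -
  let ?t = "(t0, u0, t1, u1)"
  have "?L = - (T1 ?t (Y ?t f) + Y ?t (T1 ?t f)) - (pCons 0 (Y ?t f) + Y ?t (pCons 0 f))"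
    by (simp add: S_def Y_add Y_diff Y_uminus del: minus_pCons diff_pCons add_pCons)
  also have "\<dots> = - Y ?t (Y ?t f) - T0 ?t f + pCons 0 f
      - (smult (t1\<^sup>2 - t0\<^sup>2) f + smult (t0\<^sup>2 - u0\<^sup>2 + 1/4 - t1\<^sup>2 + u1\<^sup>2) f)"
    unfolding T1_Y Y_z by (simp add: algebra_simps del: minus_pCons diff_pCons add_pCons)
  also have "smult (t1\<^sup>2 - t0\<^sup>2) f + smult (t0\<^sup>2 - u0\<^sup>2 + 1/4 - t1\<^sup>2 + u1\<^sup>2) f =
      - smult (u0\<^sup>2 - u1\<^sup>2 - 1/4) f"
    by (simp only: smult_add_left[symmetric] smult_minus_left[symmetric]) (simp add: algebra_simps)
  finally show ?thesis
    by (simp add: S_def Y_def)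
qed

section \<open>Action on constants, coefficients and degrees\<close>

lemma T1_const: "T1 (t0, u0, t1, u1) [:c:] = [:t1 * c:]"
  by (simp add: T1.simps)

lemma Y_one: "Y (t0, u0, t1, u1) 1 = smult (t0 + t1) 1"
  by (simp add: Y_def T0.simps T1.simps flip: pCons_one)

text \<open>\<open>h\<close> lists the coefficients of \<open>(f(- x) - f(x)) / (2 * x)\<close>,
  which only the odd part of \<open>f\<close> enters; the three \<open>h\<close> terms come from the
  factor \<open>(t1 + x)^2 - u1^2\<close>.\<close>

lemma coeff_T1:
  fixes f :: "complex poly"
  defines "h \<equiv> \<lambda>i. if even i then - coeff f (Suc i) else 0"
  shows "coeff (T1 (t0, u0, t1, u1) f) (Suc (Suc j)) =
    t1 * coeff f (Suc (Suc j)) + (t1\<^sup>2 - u1\<^sup>2) * h (Suc (Suc j)) + 2 * t1 * h (Suc j) + h j"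
proof -
  define q where "q = (pcompose f [:0, -1:] - f) div [:0, 2:]"
  have "[:- 0, 1:] dvd pcompose f [:0, -1:] - f"
    by (simp only: poly_eq_0_iff_dvd[symmetric]) (simp add: poly_pcompose)
  then have "smult 2 [:0, 1:] dvd pcompose f [:0, -1:] - f"
    by (subst smult_dvd_iff) simp
  then have "[:0, 2:] dvd pcompose f [:0, -1:] - f"
    by simp
  then have "[:0, 2:] * q = pcompose f [:0, -1:] - f"
    unfolding q_def by (rule dvd_mult_div_cancel)
  then have "coeff (pCons 0 (smult 2 q)) (Suc i) = coeff (pcompose f [:0, -1:] - f) (Suc i)" for i
    by simp
  then have "2 * coeff q i = 2 * h i" for i
    by (simp add: coeff_pcompose_linear h_def)
  then have q: "coeff q i = h i" for i
    by simp
  have "T1 (t0, u0, t1, u1) f = smult t1 f + smult (t1\<^sup>2 - u1\<^sup>2) q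
      + smult (2 * t1) (pCons 0 q) + pCons 0 (pCons 0 q)"
    by (simp add: T1.simps q_def[symmetric] power2_eq_square algebra_simps smult_add_left smult_diff_left)
  then show ?thesis
    by (simp add: q)
qed

text \<open>Only the odd part of \<open>f\<close> is divided by \<open>x\<close> and multiplied by a
  quadratic, which adds one to its degree. So \<open>T1\<close> respects even degree bounds and
  climbs from odd ones; this parity decides which intertwiner raises the degree.\<close>

lemma degree_T1_even:
  assumes "degree f \<le> 2 * n"
  shows "degree (T1 (t0, u0, t1, u1) f) \<le> 2 * n"
proof (cases "n = 0")
  case True
  then obtain c where "f = [:c:]"
    using assms degree_eq_zeroE[of f] by auto
  then show ?thesis
    by (simp add: T1_const)
next
  case False
  show ?thesis
  proof (rule degree_le, intro allI impI)
    fix i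
    assume "2 * n < i"
    moreover define j where "j = i - 2"
    ultimately have "i = Suc (Suc j)"
      using False by simp
    \<comment> \<open>For odd \<open>j\<close> the term \<open>h j\<close> is zero by parity, which
      settles \<open>i = 2 * n + 1\<close>.\<close>
    moreover from this have "coeff f (Suc j) = 0" if "even j"
      using that assms \<open>2 * n < i\<close> by (intro coeff_eq_0) presburger
    ultimately show "coeff (T1 (t0, u0, t1, u1) f) i = 0"
      using assms \<open>2 * n < i\<close> by (auto simp: coeff_T1 coeff_eq_0)
  qed
qed

lemma degree_T1_odd:
  assumes "degree f \<le> 2 * n + 1"
  shows "degree (T1 (t0, u0, t1, u1) f) \<le> 2 * n + 2"
    and "coeff (T1 (t0, u0, t1, u1) f) (2 * n + 2) = - coeff f (2 * n + 1)"
proof -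
  show "degree (T1 (t0, u0, t1, u1) f) \<le> 2 * n + 2"
  proof (rule degree_le, intro allI impI)
    fix i
    assume "2 * n + 2 < i"
    moreover define j where "j = i - 2"
    ultimately have "i = Suc (Suc j)"
      by simp
    then show "coeff (T1 (t0, u0, t1, u1) f) i = 0"
      using assms \<open>2 * n + 2 < i\<close> by (auto simp: coeff_T1 coeff_eq_0)
  qed
  show "coeff (T1 (t0, u0, t1, u1) f) (2 * n + 2) = - coeff f (2 * n + 1)"
    using assms by (simp add: coeff_T1 coeff_eq_0)
qed

section \<open>Values at the normalization point, and intertwiners\<close>

text \<open>The factor \<open>t1 + u1 + x\<close> kills the difference term at this point.\<close>

lemma poly_T1_base: "poly (T1 (t0, u0, t1, u1) f) (- (t1 + u1)) = t1 * poly f (- (t1 + u1))"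
  by (simp add: T1.simps del: mult_pCons_left mult_pCons_right)

lemma poly_S_base: "poly (S (t0, u0, t1, u1) f) (- (t1 + u1)) = u1 * poly f (- (t1 + u1))"
  using poly_T1_base[of t0 u0 t1 u1 f] by (simp add: S_def algebra_simps)

text \<open>
  Since \<open>T1\<close> nearly anticommutes with \<open>Y\<close>, and \<open>S\<close> with \<open>Y + 1/2\<close>, shifted by suitable scalars
  they intertwine the eigenspaces of \<open>Y\<close> for \<open>g\<close> and \<open>- g\<close>, and for \<open>g\<close> and \<open>- (g + 1)\<close>.
\<close>

lemma T1_intertwines:
  assumes "Y (t0, u0, t1, u1) p = smult g p" and "g \<noteq> 0"
  defines "a \<equiv> (g\<^sup>2 + t1\<^sup>2 - t0\<^sup>2) / (2 * g)"
  defines "v \<equiv> T1 (t0, u0, t1, u1) p - smult a p"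
  shows "Y (t0, u0, t1, u1) v = smult (- g) v"
proof -
  have "2 * a * g = g\<^sup>2 + t1\<^sup>2 - t0\<^sup>2"
    using assms(2) by (simp add: a_def)
  \<comment> \<open>The left side is the coefficient of \<open>p\<close> in \<open>Y v\<close>, the
    right side that in \<open>- g v\<close>; this equation dictates the choice of
    \<open>a\<close>.\<close>
  then have a: "g * g + (t1\<^sup>2 - t0\<^sup>2) - a * g = a * g"
    by (simp add: algebra_simps power2_eq_square)
  have "Y (t0, u0, t1, u1) v = Y (t0, u0, t1, u1) (T1 (t0, u0, t1, u1) p) - smult (a * g) p"
    by (simp add: v_def Y_diff Y_smult assms(1))
  also have "Y (t0, u0, t1, u1) (T1 (t0, u0, t1, u1) p) =
      smult (g * g + (t1\<^sup>2 - t0\<^sup>2)) p - smult g (T1 (t0, u0, t1, u1) p)"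
    using T1_Y[of t0 u0 t1 u1 p] unfolding assms(1) Y_smult T1_smult
    by (simp add: smult_add_left eq_diff_eq add.commute)
  also have "\<dots> - smult (a * g) p = smult (g * g + (t1\<^sup>2 - t0\<^sup>2) - a * g) p
      - smult g (T1 (t0, u0, t1, u1) p)"
    by (simp add: smult_diff_left)
  also have "\<dots> = smult (- g) v"
    unfolding a by (simp add: v_def smult_diff_right mult.commute)
  finally show ?thesis .
qed

lemma S_intertwines:
  assumes "Y (t0, u0, t1, u1) p = smult g p" and "2 * g + 1 \<noteq> 0"
  defines "a \<equiv> (u0\<^sup>2 - u1\<^sup>2 - (g + 1/2)\<^sup>2) / (2 * g + 1)"
  defines "v \<equiv> S (t0, u0, t1, u1) p - smult a p"
  shows "Y (t0, u0, t1, u1) v = smult (- (g + 1)) v"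
proof -
  have "a * (2 * g + 1) = u0\<^sup>2 - u1\<^sup>2 - (g + 1/2)\<^sup>2"
    using assms(2) by (simp add: a_def)
  then have a: "u0\<^sup>2 - u1\<^sup>2 - 1/4 - g * g - g - a * g = a * (g + 1)"
    by (simp add: field_simps power2_eq_square)
  have "Y (t0, u0, t1, u1) v = Y (t0, u0, t1, u1) (S (t0, u0, t1, u1) p) - smult (a * g) p"
    by (simp add: v_def Y_diff Y_smult assms(1))
  also have "Y (t0, u0, t1, u1) (S (t0, u0, t1, u1) p) =
      smult (u0\<^sup>2 - u1\<^sup>2 - 1/4 - g * g - g) p - smult (g + 1) (S (t0, u0, t1, u1) p)"
    using S_Y[of t0 u0 t1 u1 p] unfolding assms(1) Y_smult S_smult
    by (simp add: algebra_simps smult_add_left smult_diff_left)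
  also have "\<dots> - smult (a * g) p = smult (u0\<^sup>2 - u1\<^sup>2 - 1/4 - g * g - g - a * g) p
      - smult (g + 1) (S (t0, u0, t1, u1) p)"
    by (simp add: smult_diff_left)
  also have "\<dots> = smult (- (g + 1)) v"
    unfolding a
    by (simp only: v_def smult_diff_right smult_minus_left smult_smult mult.commute[of a] mult_minus_left) simp
  finally show ?thesis .
qed

section \<open>Genericity and the spectrum\<close>

text \<open>Unlike \<open>generic\<close>, this weaker condition is symmetric under \<open>sigma\<close>.\<close>

fun regular :: "params \<Rightarrow> bool" where
  "regular (t0, u0, t1, u1) \<longleftrightarrow>
     (\<forall>k::nat. 2 * (t0 + t1) + of_nat (Suc k) \<noteq> 0 \<and> 2 * (t1 + u1) + of_nat (Suc k) \<noteq> 0 \<and>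
        2 * t1 + of_nat (Suc k) \<noteq> 0 \<and>
        t0 + t1 + u1 + u0 + 1/2 + of_nat k \<noteq> 0 \<and> t0 + t1 + u1 - u0 + 1/2 + of_nat k \<noteq> 0)"

lemma generic_imp_regular:
  assumes "generic t"
  shows "regular t"
proof -
  obtain t0 u0 t1 u1 where t: "t = (t0, u0, t1, u1)"
    by (cases t)
  have sum: "\<forall>i j. i < j \<and> j < 4 \<longrightarrow>
      [t1 + u1, t1 - u1, t0 + u0 + 1/2, t0 - u0 + 1/2] ! i +
      [t1 + u1, t1 - u1, t0 + u0 + 1/2, t0 - u0 + 1/2] ! j \<notin> \<int>"
    using assms unfolding t generic.simps Let_def by blast
  have 1: "2 * (t0 + t1) + of_nat (Suc k) \<noteq> 0" for k
  proof
    assume "2 * (t0 + t1) + of_nat (Suc k) = 0"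
    then have "t0 + t1 = - (of_nat (Suc k) / 2)"
      by (simp add: field_simps add_eq_0_iff)
    moreover have "\<forall>k::nat. k \<ge> 1 \<longrightarrow> t0 + t1 \<noteq> - (of_nat k / 2)"
      using assms unfolding t generic.simps Let_def by blast
    ultimately show False
      by (metis le_add1 plus_1_eq_Suc)
  qed
  have 2: "2 * (t1 + u1) + of_nat (Suc k) \<noteq> 0" for k
  proof
    assume "2 * (t1 + u1) + of_nat (Suc k) = 0"
    then have "t1 + u1 = - (of_nat (Suc k) / 2)"
      by (simp add: field_simps add_eq_0_iff)
    moreover have "\<forall>k::nat. t1 + u1 \<noteq> - (of_nat k / 2)"
      using assms unfolding t generic.simps Let_def by simp
    ultimately show False
      by metis
  qed
  have Ints: "x + of_nat k \<noteq> 0" if "x \<notin> \<int>" for x :: complex and k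
    using that by (metis Ints_minus Ints_of_nat eq_neg_iff_add_eq_0)
  \<comment> \<open>These are the sums of the first entry of the list in \<open>generic\<close> with
    the other three.\<close>
  have "2 * t1 \<notin> \<int>" "t0 + t1 + u1 + u0 + 1/2 \<notin> \<int>" "t0 + t1 + u1 - u0 + 1/2 \<notin> \<int>"
    using sum[rule_format, of 0 1] sum[rule_format, of 0 2] sum[rule_format, of 0 3]
    by (simp_all add: algebra_simps eval_nat_numeral)
  then show ?thesis
    unfolding t regular.simps using 1 2 Ints by blast
qed

lemma regular_sigma: "regular (sigma t) \<longleftrightarrow> regular t"
  by (cases t) (simp add: algebra_simps; blast)

lemma gamma_even: "gamma (t0, u0, t1, u1) (2 * n) = t0 + t1 + of_nat n"
  by simp

lemma gamma_odd: "gamma (t0, u0, t1, u1) (2 * n + 1) = - (t0 + t1 + of_nat (n + 1))"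
  by simp

lemma gamma_0: "gamma (t0, u0, t1, u1) 0 = t0 + t1"
  by simp

lemma xspec_0: "xspec (t0, u0, t1, u1) 0 = t1 + u1"
  by simp

lemma xspec_eq: "xspec t = gamma (sigma t)"
  by (simp add: fun_eq_iff xspec_eq_gamma_sigma)

declare gamma.simps [simp del] xspec.simps [simp del]

text \<open>Keeps the denominator in \<open>T1_intertwines\<close> nonzero. Index 0 is left out
  because \<open>t0 + t1 = 0\<close> is admissible.\<close>

lemma gamma_neq_0:
  assumes "regular (t0, u0, t1, u1)" "m > 0"
  shows "gamma (t0, u0, t1, u1) m \<noteq> 0"
proof -
  have "2 * (t0 + t1) + of_nat (Suc (2 * n + 1)) \<noteq> 0" for n
    using assms(1) unfolding regular.simps by blast
  moreover have "2 * (t0 + t1) + of_nat (Suc (2 * n + 1)) = 2 * (t0 + t1 + of_nat (Suc n))" for n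
    by (simp add: algebra_simps)
  ultimately have *: "t0 + t1 + of_nat (Suc n) \<noteq> 0" for n
    by (metis mult_zero_right)
  show ?thesis
  proof (cases "even m")
    case True
    then obtain n where "m = 2 * Suc n"
      using assms(2) by (metis evenE not0_implies_Suc mult_0_right less_irrefl)
    then show ?thesis
      using * by (simp only: gamma_even) simp
  next
    case False
    then obtain n where "m = 2 * n + 1"
      by (rule oddE)
    then show ?thesis
      using *[of n] by (simp only: gamma_odd neg_equal_0_iff_equal) simp
  qed
qed

lemma gamma_neq_half:
  assumes "regular (t0, u0, t1, u1)"
  shows "2 * gamma (t0, u0, t1, u1) m + 1 \<noteq> 0"
proof -
  have *: "2 * (t0 + t1) + of_nat (Suc (2 * n)) \<noteq> 0" for n
    using assms(1) unfolding regular.simps by blast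
  show ?thesis
  proof (cases "even m")
    case True
    then obtain n where "m = 2 * n"
      by (rule evenE)
    then show ?thesis
      using *[of n] by (simp only: gamma_even) (simp add: algebra_simps)
  next
    case False
    then obtain n where m: "m = 2 * n + 1"
      by (rule oddE)
    show ?thesis
    proof
      assume "2 * gamma (t0, u0, t1, u1) m + 1 = 0"
      moreover have "2 * (t0 + t1) + of_nat (Suc (2 * n)) = - (2 * gamma (t0, u0, t1, u1) m + 1)"
        unfolding m gamma_odd by (simp add: algebra_simps)
      ultimately have "2 * (t0 + t1) + of_nat (Suc (2 * n)) = 0"
        by simp
      then show False
        using * by blast
    qed
  qed
qed

text \<open>A coincidence across parities would make \<open>2 * (t0 + t1)\<close> a negative
  integer.\<close>

lemma gamma_inj:
  assumes "regular (t0, u0, t1, u1)"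
  shows "inj (gamma (t0, u0, t1, u1))"
proof (rule injI)
  fix m n
  assume eq: "gamma (t0, u0, t1, u1) m = gamma (t0, u0, t1, u1) n"
  have *: "gamma (t0, u0, t1, u1) (2 * i) \<noteq> gamma (t0, u0, t1, u1) (2 * j + 1)" for i j
  proof
    assume "gamma (t0, u0, t1, u1) (2 * i) = gamma (t0, u0, t1, u1) (2 * j + 1)"
    then have "2 * (t0 + t1) + of_nat (Suc (i + j)) = 0"
      unfolding gamma_even gamma_odd by (simp add: algebra_simps add_eq_0_iff)
    then show False
      using assms unfolding regular.simps by blast
  qed
  show "m = n"
  proof (cases "even m")
    case True
    then obtain i where m: "m = 2 * i"
      by (rule evenE)
    show ?thesis
    proof (cases "even n")
      case True
      then obtain j where "n = 2 * j"
        by (rule evenE)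
      then show ?thesis
        using eq unfolding m by (simp add: gamma_even)
    next
      case False
      then show ?thesis
        using eq * unfolding m by (metis oddE)
    qed
  next
    case False
    then obtain i where m: "m = 2 * i + 1"
      by (rule oddE)
    show ?thesis
    proof (cases "even n")
      case True
      then show ?thesis
        using eq * unfolding m by (metis evenE)
    next
      case False
      then obtain j where n: "n = 2 * j + 1"
        by (rule oddE)
      then show ?thesis
        using eq unfolding m n gamma_odd by simp
    qed
  qed
qed

section \<open>Eigenvectors of \<open>Y\<close>\<close>

text \<open>Induction along the intertwiners: \<open>S\<close> leads from even to odd degree,
  \<open>T1\<close> from odd to even. The value at \<open>- (t1 + u1)\<close> is multiplied by
  \<open>u1 - a\<close> or \<open>t1 - a\<close>, whose numerators factor into quantities that
  \<open>regular\<close> keeps nonzero.\<close>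

lemma eigenvector_exists:
  assumes "regular (t0, u0, t1, u1)"
  shows "\<exists>p. lead_coeff p = 1 \<and> degree p = m \<and>
    Y (t0, u0, t1, u1) p = smult (gamma (t0, u0, t1, u1) m) p \<and> poly p (- (t1 + u1)) \<noteq> 0"
proof (induction m)
  case 0
  show ?case
    by (intro exI[of _ 1]) (simp add: Y_one gamma_0)
next
  case (Suc m)
  let ?t = "(t0, u0, t1, u1)" and ?x = "- (t1 + u1)"
  obtain p where p: "lead_coeff p = 1" "degree p = m" "Y ?t p = smult (gamma ?t m) p" "poly p ?x \<noteq> 0"
    using Suc.IH by blast
  \<comment> \<open>Both intertwiners produce leading coefficient \<open>- 1\<close>; the sign is
    removed at the end.\<close>
  obtain v where v: "degree v \<le> Suc m" "coeff v (Suc m) = - 1" "poly v ?x \<noteq> 0"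
      "Y ?t v = smult (gamma ?t (Suc m)) v"
  proof (cases "even m")
    case True
    then obtain n where m: "m = 2 * n"
      by (rule evenE)
    define g where "g = t0 + t1 + of_nat n"
    have g: "gamma ?t m = g" "- (g + 1) = gamma ?t (Suc m)"
      using gamma_odd[of t0 u0 t1 u1 n] by (simp_all add: m gamma_even g_def)
    define a where "a = (u0\<^sup>2 - u1\<^sup>2 - (g + 1/2)\<^sup>2) / (2 * g + 1)"
    define v where "v = S ?t p - smult a p"
    have g0: "2 * g + 1 \<noteq> 0"
      using gamma_neq_half[OF assms, of m] by (simp add: g)
    have T1p: "degree (T1 ?t p) \<le> m"
      using degree_T1_even[of p n] p(2) m by simp
    \<comment> \<open>The left side equals \<open>(g + 1/2 + u1)^2 - u0^2\<close>.\<close>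
    have "(u1 - a) * (2 * g + 1) =
        (t0 + t1 + u1 + u0 + 1/2 + of_nat n) * (t0 + t1 + u1 - u0 + 1/2 + of_nat n)"
      using g0 unfolding a_def left_diff_distrib
      by (simp add: g_def) (simp add: field_simps power2_eq_square)
    then have "u1 - a \<noteq> 0"
      using assms unfolding regular.simps by (metis mult_eq_0_iff)
    then have "poly v ?x \<noteq> 0"
      unfolding v_def poly_diff poly_S_base poly_smult left_diff_distrib[symmetric] using p(4) by simp
    moreover have "Y ?t v = smult (gamma ?t (Suc m)) v"
      using S_intertwines[OF p(3)] g g0 by (simp add: v_def a_def)
    moreover have "degree v \<le> Suc m"
      using p(2) T1p unfolding v_def S_def
      by (intro degree_diff_le)
        (simp_all only: degree_minus, auto intro!: degree_add_le simp: degree_pCons_eq_if)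
    moreover have "coeff v (Suc m) = - 1"
      using p(1,2) T1p by (simp add: v_def S_def coeff_eq_0)
    ultimately show ?thesis
      using that by blast
  next
    case False
    then obtain n where m: "m = 2 * n + 1"
      by (rule oddE)
    define g where "g = - (t0 + t1 + of_nat (n + 1))"
    have g: "gamma ?t m = g" "- g = gamma ?t (Suc m)"
      using gamma_even[of t0 u0 t1 u1 "n + 1"] gamma_odd[of t0 u0 t1 u1 n] by (simp_all add: m g_def)
    define a where "a = (g\<^sup>2 + t1\<^sup>2 - t0\<^sup>2) / (2 * g)"
    define v where "v = T1 ?t p - smult a p"
    have g0: "g \<noteq> 0"
      using gamma_neq_0[OF assms, of m] unfolding g(1) by (simp add: m)
    \<comment> \<open>The left side equals \<open>t0^2 - (g - t1)^2\<close>.\<close>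
    have "(t1 - a) * (2 * g) = - ((2 * (t0 + t1) + of_nat (Suc n)) * (2 * t1 + of_nat (Suc n)))"
    proof -
      have "a * (2 * g) = g\<^sup>2 + t1\<^sup>2 - t0\<^sup>2"
        using g0 by (simp add: a_def)
      then show ?thesis
        unfolding left_diff_distrib g_def by (simp add: algebra_simps power2_eq_square)
    qed
    moreover have "(2 * (t0 + t1) + of_nat (Suc n)) * (2 * t1 + of_nat (Suc n)) \<noteq> 0"
      using assms unfolding regular.simps by (metis mult_eq_0_iff)
    ultimately have "t1 - a \<noteq> 0"
      by (metis mult_zero_left neg_equal_0_iff_equal)
    then have "poly v ?x \<noteq> 0"
      unfolding v_def poly_diff poly_T1_base poly_smult left_diff_distrib[symmetric] using p(4) by simp
    moreover have "Y ?t v = smult (gamma ?t (Suc m)) v"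
      using T1_intertwines[OF p(3)] g g0 by (simp add: v_def a_def)
    moreover have "degree v \<le> Suc m"
      using p(2) degree_T1_odd(1)[of p n] m unfolding v_def by (intro degree_diff_le) auto
    moreover have "coeff v (Suc m) = - 1"
      using p(1,2) degree_T1_odd(2)[of p n] m by (simp add: v_def coeff_eq_0)
    ultimately show ?thesis
      using that by blast
  qed
  have "degree v = Suc m"
    using v(1,2) by (metis le_antisym le_degree neg_equal_0_iff_equal one_neq_zero)
  then show ?case
    using v by (intro exI[of _ "- v"]) (simp add: Y_uminus)
qed

text \<open>Derived from the eigenvectors rather than from a degree estimate for \<open>T0\<close>:
  subtracting a multiple of the one of degree \<open>Suc m\<close> lowers the degree of
  \<open>f\<close>.\<close>

lemma Y_triangular:
  assumes "regular (t0, u0, t1, u1)"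
  shows "degree f \<le> m \<Longrightarrow> degree (Y (t0, u0, t1, u1) f) \<le> m \<and>
    coeff (Y (t0, u0, t1, u1) f) m = gamma (t0, u0, t1, u1) m * coeff f m"
proof (induction m arbitrary: f)
  case 0
  then obtain c where "f = [:c:]"
    by (metis degree_eq_zeroE le_zero_eq)
  then have "f = smult c 1"
    by simp
  then have "Y (t0, u0, t1, u1) f = smult (t0 + t1) f"
    by (simp only: Y_smult Y_one smult_smult mult.commute)
  then show ?case
    using 0 by (simp add: gamma_0)
next
  case (Suc m)
  let ?t = "(t0, u0, t1, u1)"
  obtain p where p: "lead_coeff p = 1" "degree p = Suc m" "Y ?t p = smult (gamma ?t (Suc m)) p"
    using eigenvector_exists[OF assms, of "Suc m"] by blast
  define r where "r = f - smult (coeff f (Suc m)) p"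
  have f: "f = smult (coeff f (Suc m)) p + r"
    by (simp add: r_def)
  have "degree r \<le> Suc m"
    unfolding r_def using Suc.prems p(2) by (intro degree_diff_le) auto
  moreover have "coeff r (Suc m) = 0"
    using p(1,2) by (simp add: r_def)
  ultimately have "degree r \<le> m"
    by (metis degree_0 le_SucE leading_coeff_0_iff zero_le)
  then have "degree (Y ?t r) \<le> m"
    using Suc.IH by blast
  moreover have "Y ?t f = smult (coeff f (Suc m) * gamma ?t (Suc m)) p + Y ?t r"
    by (subst f) (simp only: Y_add Y_smult p smult_smult)
  ultimately show ?case
    using p(1,2) by (auto simp: coeff_eq_0 intro!: degree_add_le)
qed

lemma eigenvalue_eq_gamma:
  assumes "regular (t0, u0, t1, u1)" "Y (t0, u0, t1, u1) f = smult g f" "f \<noteq> 0"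
  shows "g = gamma (t0, u0, t1, u1) (degree f)"
  using Y_triangular[OF assms(1), of f "degree f"] assms(2,3) by simp

text \<open>Justifies the definite description: two candidates would differ by an eigenvector for
  \<open>gamma t m\<close> of degree other than \<open>m\<close>, contrary to injectivity of
  \<open>gamma\<close>.\<close>

lemma wilson_poly_spec:
  assumes "regular (t0, u0, t1, u1)"
  defines "t \<equiv> (t0, u0, t1, u1)"
  shows "lead_coeff (wilson_poly t m) = 1" "degree (wilson_poly t m) = m"
    "Y t (wilson_poly t m) = smult (gamma t m) (wilson_poly t m)"
    "poly (wilson_poly t m) (- (t1 + u1)) \<noteq> 0"
proof -
  obtain p where p: "lead_coeff p = 1" "degree p = m" "Y t p = smult (gamma t m) p"
      "poly p (- (t1 + u1)) \<noteq> 0"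
    using eigenvector_exists[OF assms(1)] unfolding t_def by blast
  have "q = p" if q: "lead_coeff q = 1" "degree q = m" "Y t q = smult (gamma t m) q" for q
  proof (rule ccontr)
    assume "q \<noteq> p"
    then have d: "q - p \<noteq> 0"
      by simp
    have "Y t (q - p) = smult (gamma t m) (q - p)"
      by (simp add: Y_diff p q smult_diff_right)
    then have "gamma t m = gamma t (degree (q - p))"
      using eigenvalue_eq_gamma[OF assms(1)] d unfolding t_def by blast
    then have "degree (q - p) = m"
      using gamma_inj[OF assms(1)] unfolding t_def by (metis injD)
    moreover have "coeff (q - p) m = 0"
      using p q by simp
    ultimately show False
      using d by (metis leading_coeff_0_iff)
  qed
  then have "wilson_poly t m = p"
    unfolding wilson_poly_def using p(1-3) by (intro the_equality) blast+
  then show "lead_coeff (wilson_poly t m) = 1" "degree (wilson_poly t m) = m"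
    "Y t (wilson_poly t m) = smult (gamma t m) (wilson_poly t m)"
    "poly (wilson_poly t m) (- (t1 + u1)) \<noteq> 0"
    using p by simp_all
qed

lemma
  assumes "regular (t0, u0, t1, u1)"
  defines "t \<equiv> (t0, u0, t1, u1)"
  shows degree_E: "degree (E t m) = m"
    and Y_E: "Y t (E t m) = smult (gamma t m) (E t m)"
    and poly_E_base: "poly (E t m) (- (t1 + u1)) = 1"
  using wilson_poly_spec[OF assms(1)] unfolding t_def
  by (auto simp: E_def Y_smult xspec_0 mult.commute)

text \<open>Each eigenspace is a line, so identities between eigenvectors reduce to comparing one
  value.\<close>

lemma eigenvector_eq_E:
  assumes "regular (t0, u0, t1, u1)"
  defines "t \<equiv> (t0, u0, t1, u1)"
  assumes f: "Y t f = smult (gamma t m) f"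
  shows "f = smult (poly f (- (t1 + u1))) (E t m)"
proof -
  have E: "degree (E t m) = m" "Y t (E t m) = smult (gamma t m) (E t m)"
      "poly (E t m) (- (t1 + u1)) = 1"
    using degree_E Y_E poly_E_base assms(1) unfolding t_def by blast+
  have eigen: "degree g = m" if "Y t g = smult (gamma t m) g" "g \<noteq> 0" for g
    using eigenvalue_eq_gamma[OF assms(1), of g] gamma_inj[OF assms(1)] that
    unfolding t_def by (metis injD)
  define c where "c = coeff f m / coeff (E t m) m"
  have "E t m \<noteq> 0"
    using E(3) by auto
  then have "coeff (E t m) m \<noteq> 0"
    using E(1) by (metis leading_coeff_0_iff)
  then have "coeff (f - smult c (E t m)) m = 0"
    by (simp add: c_def)
  moreover have "Y t (f - smult c (E t m)) = smult (gamma t m) (f - smult c (E t m))"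
    by (simp add: Y_diff Y_smult E f smult_diff_right mult.commute)
  ultimately have "f - smult c (E t m) = 0"
    using eigen by (metis leading_coeff_0_iff)
  then have "f = smult c (E t m)"
    by simp
  moreover from this have "poly f (- (t1 + u1)) = c"
    by (metis E(3) poly_smult mult.right_neutral)
  ultimately show ?thesis
    by metis
qed

lemma E_0:
  assumes "regular (t0, u0, t1, u1)"
  shows "E (t0, u0, t1, u1) 0 = 1"
  using eigenvector_eq_E[OF assms, of 1 0] by (simp add: Y_one gamma_0)

text \<open>Serves as an induction rule for linear statements, as there is one \<open>E\<close> in
  each degree.\<close>

lemma span_E:
  assumes t: "regular (t0, u0, t1, u1)"
    and add: "\<And>f g. P f \<Longrightarrow> P g \<Longrightarrow> P (f + g)"
    and smult: "\<And>c f. P f \<Longrightarrow> P (smult c f)"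
    and E: "\<And>n. P (E (t0, u0, t1, u1) n)"
  shows "P f"
proof -
  have "degree f < n \<Longrightarrow> P f" for n
  proof (induction n arbitrary: f)
    case (Suc n)
    let ?e = "E (t0, u0, t1, u1) n"
    have "?e \<noteq> 0"
      using poly_E_base[OF t, of n] by auto
    then have e: "degree ?e = n" "coeff ?e n \<noteq> 0"
      using degree_E[OF t, of n] by (auto simp: leading_coeff_0_iff[symmetric])
    define r where "r = f - smult (coeff f n / coeff ?e n) ?e"
    have f: "f = smult (coeff f n / coeff ?e n) ?e + r"
      by (simp add: r_def)
    have "degree r \<le> n"
      unfolding r_def using Suc.prems e(1) by (intro degree_diff_le) auto
    moreover have "coeff r n = 0"
      using e(2) by (simp add: r_def)
    \<comment> \<open>For \<open>n = 0\<close> only the second alternative is possible.\<close>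
    ultimately have "degree r < n \<or> r = 0"
      by (metis le_neq_implies_less leading_coeff_0_iff)
    then have "P r"
      using Suc.IH smult[OF E[of 0], of 0] by auto
    then show ?case
      by (subst f) (intro add smult E)
  qed simp
  then show ?thesis
    by blast
qed

section \<open>The operators \<open>T1\<close> and \<open>S\<close> on the eigenbasis\<close>

text \<open>The index with eigenvalue \<open>- gamma t m\<close>. At \<open>m = 0\<close> truncated
  subtraction returns 0, a mere placeholder.\<close>

definition T1_partner :: "nat \<Rightarrow> nat" where
  "T1_partner m = (if even m then m - 1 else m + 1)"

definition S_partner :: "nat \<Rightarrow> nat" where
  "S_partner m = (if even m then m + 1 else m - 1)"

lemma gamma_T1_partner:
  assumes "m > 0"
  shows "gamma t (T1_partner m) = - gamma t m"
proof (cases t)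
  case (fields t0 u0 t1 u1)
  show ?thesis
  proof (cases "even m")
    case True
    then obtain n where "m = 2 * Suc n"
      using assms by (metis evenE not0_implies_Suc mult_0_right less_irrefl)
    then show ?thesis
      by (simp add: fields gamma.simps T1_partner_def)
  next
    case False
    then show ?thesis
      by (simp add: fields gamma.simps T1_partner_def)
  qed
qed

lemma gamma_S_partner: "gamma t (S_partner m) = - (gamma t m + 1)"
proof (cases t)
  case (fields t0 u0 t1 u1)
  show ?thesis
  proof (cases "even m")
    case True
    then show ?thesis
      by (auto simp: fields gamma.simps S_partner_def)
  next
    case False
    then obtain n where "m = 2 * n + 1"
      by (rule oddE)
    then show ?thesis
      by (simp add: fields gamma.simps S_partner_def)
  qed
qed

text \<open>By \<open>T1_intertwines\<close> the vector \<open>v\<close> lies on the line of the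
  partner; its coefficient is its value at the normalization point, where \<open>T1\<close> acts by
  \<open>t1\<close>.\<close>

lemma T1_E:
  assumes "regular (t0, u0, t1, u1)" "m > 0"
  defines "t \<equiv> (t0, u0, t1, u1)"
  defines "a \<equiv> ((gamma t m)\<^sup>2 + t1\<^sup>2 - t0\<^sup>2) / (2 * gamma t m)"
  shows "T1 t (E t m) = smult a (E t m) + smult (t1 - a) (E t (T1_partner m))"
proof -
  define v where "v = T1 t (E t m) - smult a (E t m)"
  have "Y t v = smult (gamma t (T1_partner m)) v"
    using T1_intertwines[OF Y_E[OF assms(1)] gamma_neq_0[OF assms(1,2)]] gamma_T1_partner[OF assms(2)]
    unfolding v_def a_def t_def by simp
  then have "v = smult (poly v (- (t1 + u1))) (E t (T1_partner m))"
    using eigenvector_eq_E[OF assms(1)] unfolding t_def by blast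
  moreover have "poly v (- (t1 + u1)) = t1 - a"
    unfolding v_def t_def poly_diff poly_T1_base poly_smult poly_E_base[OF assms(1)] by simp
  ultimately have "v = smult (t1 - a) (E t (T1_partner m))"
    by simp
  then show ?thesis
    unfolding v_def by (simp only: diff_eq_eq add.commute)
qed

lemma S_E:
  fixes m :: nat
  assumes "regular (t0, u0, t1, u1)"
  defines "t \<equiv> (t0, u0, t1, u1)"
  defines "a \<equiv> (u0\<^sup>2 - u1\<^sup>2 - (gamma t m + 1/2)\<^sup>2) / (2 * gamma t m + 1)"
  shows "S t (E t m) = smult a (E t m) + smult (u1 - a) (E t (S_partner m))"
proof -
  define v where "v = S t (E t m) - smult a (E t m)"
  have "Y t v = smult (gamma t (S_partner m)) v"
    using S_intertwines[OF Y_E[OF assms(1)] gamma_neq_half[OF assms(1)]] gamma_S_partner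
    unfolding v_def a_def t_def by simp
  then have "v = smult (poly v (- (t1 + u1))) (E t (S_partner m))"
    using eigenvector_eq_E[OF assms(1)] unfolding t_def by blast
  moreover have "poly v (- (t1 + u1)) = u1 - a"
    unfolding v_def t_def poly_diff poly_S_base poly_smult poly_E_base[OF assms(1)] by simp
  ultimately have "v = smult (u1 - a) (E t (S_partner m))"
    by simp
  then show ?thesis
    unfolding v_def by (simp only: diff_eq_eq add.commute)
qed

section \<open>The bilinear form and its adjoint pairs\<close>

text \<open>\<open>poly_act L p\<close> is the operator \<open>p(L)\<close>, provided that \<open>L 0 = 0\<close>.\<close>

definition poly_act :: "poly_op \<Rightarrow> complex poly \<Rightarrow> poly_op" where
  "poly_act L p f = fold_coeffs (\<lambda>a g. smult a f + L g) p 0"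

lemma poly_act_0 [simp]: "poly_act L 0 f = 0"
  by (simp add: poly_act_def)

lemma poly_act_pCons [simp]:
  "L 0 = 0 \<Longrightarrow> poly_act L (pCons a p) f = smult a f + L (poly_act L p f)"
  by (cases "p = 0 \<and> a = 0") (auto simp: poly_act_def fold_coeffs_pCons_eq)

text \<open>
  By construction the multiplication by \<open>x\<close> is adjoint to \<open>- Y (sigma t)\<close> for this form, and
  \<open>pairing t p (E (sigma t) n) = p (- x\<^sub>n)\<close>; the duality results from its symmetry, i.e.
  \<open>pairing t (E t m) q = q (- \<gamma>\<^sub>m)\<close>.
\<close>

definition pairing :: "params \<Rightarrow> complex poly \<Rightarrow> complex poly \<Rightarrow> complex" where
  "pairing t p q = poly (poly_act (\<lambda>f. - Y (sigma t) f) p q) (- gamma t 0)"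

lemma pairing_add: "pairing t p (f + g) = pairing t p f + pairing t p g"
proof -
  have "poly_act (\<lambda>f. - Y (sigma t) f) p (f + g) =
      poly_act (\<lambda>f. - Y (sigma t) f) p f + poly_act (\<lambda>f. - Y (sigma t) f) p g"
    using Y_smult[of _ 0 0] by (induction p) (simp_all add: Y_add smult_add_right)
  then show ?thesis
    by (simp add: pairing_def)
qed

lemma pairing_smult: "pairing t p (smult c f) = c * pairing t p f"
proof -
  have "poly_act (\<lambda>f. - Y (sigma t) f) p (smult c f) =
      smult c (poly_act (\<lambda>f. - Y (sigma t) f) p f)"
    using Y_smult[of _ 0 0]
    by (induction p) (simp_all add: Y_smult smult_diff_right mult.commute)
  then show ?thesis
    by (simp add: pairing_def)
qed

lemma pairing_uminus: "pairing t p (- f) = - pairing t p f"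
  using pairing_smult[of t p "-1" f] by simp

lemma pairing_diff: "pairing t p (f - g) = pairing t p f - pairing t p g"
  using pairing_add[of t p f "- g"] by (simp add: pairing_uminus)

text \<open>\<open>E (sigma t) n\<close> is an eigenvector of \<open>- Y (sigma t)\<close> for
  \<open>- xspec t n\<close>, so \<open>p\<close> of this operator acts on it by a scalar; its value
  at \<open>- gamma t 0\<close> is 1.\<close>

lemma pairing_E:
  assumes "regular t"
  shows "pairing t p (E (sigma t) n) = poly p (- xspec t n)"
proof -
  obtain t0 u0 t1 u1 where t: "t = (t0, u0, t1, u1)"
    by (cases t)
  have s: "regular (u1, u0, t1, t0)"
    using assms regular_sigma[of t] by (simp add: t)
  have "poly_act (\<lambda>f. - Y (sigma t) f) p (E (sigma t) n) =
      smult (poly p (- xspec t n)) (E (sigma t) n)"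
  proof (induction p)
    case (pCons a p)
    then show ?case
      using Y_smult[of _ 0 0] Y_E[OF s, of n]
      by (simp add: t Y_smult xspec_eq smult_diff_left mult.commute)
  qed simp
  moreover have "poly (E (sigma t) n) (- gamma t 0) = 1"
    using poly_E_base[OF s, of n] by (simp add: t gamma_0 add.commute)
  ultimately show ?thesis
    by (simp add: pairing_def)
qed

lemma span_E_sigma:
  assumes "regular t"
    and "\<And>f g. P f \<Longrightarrow> P g \<Longrightarrow> P (f + g)"
    and "\<And>c f. P f \<Longrightarrow> P (smult c f)"
    and "\<And>n. P (E (sigma t) n)"
  shows "P f"
  using assms regular_sigma[of t] by (cases "sigma t") (metis span_E)

text \<open>Reduces adjointness to the vectors \<open>E (sigma t) n\<close>, where
  \<open>pairing_E\<close> turns it into an identity between values on the dual spectrum.\<close>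

lemma pairing_eqI:
  assumes "regular t"
    and "\<And>f g. L (f + g) = L f + L g" "\<And>c f. L (smult c f) = smult c (L f)"
    and "\<And>n. pairing t p' (E (sigma t) n) = pairing t p (L (E (sigma t) n))"
  shows "pairing t p' q = pairing t p (L q)"
  using assms(2-) span_E_sigma[OF assms(1), of "\<lambda>q. pairing t p' q = pairing t p (L q)" q]
  by (simp add: pairing_add pairing_smult)

lemma pairing_add_left:
  assumes "regular t"
  shows "pairing t (p + p') q = pairing t p q + pairing t p' q"
  by (rule span_E_sigma[OF assms, of "\<lambda>q. pairing t (p + p') q = pairing t p q + pairing t p' q"])
    (simp_all add: pairing_add pairing_smult pairing_E[OF assms] algebra_simps)

lemma pairing_smult_left:
  assumes "regular t"
  shows "pairing t (smult c p) q = c * pairing t p q"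
  by (rule span_E_sigma[OF assms, of "\<lambda>q. pairing t (smult c p) q = c * pairing t p q"])
    (simp_all add: pairing_add pairing_smult pairing_E[OF assms] algebra_simps)

lemma pairing_uminus_left:
  assumes "regular t"
  shows "pairing t (- p) q = - pairing t p q"
  using pairing_smult_left[OF assms, of "-1" p q] by simp

lemma pairing_z:
  assumes "regular t"
  shows "pairing t (pCons 0 p) q = pairing t p (- Y (sigma t) q)"
proof (rule pairing_eqI[OF assms])
  fix n
  obtain a b c d where s: "sigma t = (a, b, c, d)"
    by (cases "sigma t")
  show "pairing t (pCons 0 p) (E (sigma t) n) = pairing t p (- Y (sigma t) (E (sigma t) n))"
    using assms Y_E[of a b c d n] regular_sigma[of t]
    by (simp add: s[symmetric] pairing_E pairing_uminus pairing_smult xspec_eq)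
qed (simp_all add: Y_add Y_smult)

text \<open>The partner of \<open>n\<close> sits at the reflected dual point, so \<open>T1_E\<close>
  gives a combination of \<open>p (- x)\<close> and \<open>p x\<close>; its coefficients are those
  of the difference operator \<open>T1 t\<close> at \<open>- x\<close>.\<close>

lemma pairing_T1:
  assumes "regular t"
  shows "pairing t (T1 t p) q = pairing t p (T1 (sigma t) q)"
proof (rule pairing_eqI[OF assms])
  fix n
  obtain t0 u0 t1 u1 where t: "t = (t0, u0, t1, u1)"
    by (cases t)
  have s: "regular (u1, u0, t1, t0)"
    using assms regular_sigma[of t] by (simp add: t)
  show "pairing t (T1 t p) (E (sigma t) n) = pairing t p (T1 (sigma t) (E (sigma t) n))"
  \<comment> \<open>Index 0 has no partner; there both sides are \<open>t1\<close> times the value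
    of \<open>p\<close> at \<open>- xspec t 0\<close>.\<close>
  proof (cases "n = 0")
    case True
    then show ?thesis
      using T1_const[of u1 u0 t1 t0 1] poly_T1_base[of t0 u0 t1 u1 p] pairing_smult[of t p t1 1]
        pairing_E[OF assms, of p 0] pairing_E[OF assms, of "T1 t p" 0]
      by (simp add: t E_0[OF s] xspec_0 pCons_one[symmetric])
  next
    case False
    define x where "x = xspec t n"
    define a where "a = (x\<^sup>2 + t1\<^sup>2 - u1\<^sup>2) / (2 * x)"
    have x: "x \<noteq> 0" "xspec t (T1_partner n) = - x"
      using gamma_neq_0[OF s, of n] gamma_T1_partner[of n "sigma t"] False
      by (simp_all add: x_def xspec_eq t)
    have "T1 (sigma t) (E (sigma t) n) =
        smult a (E (sigma t) n) + smult (t1 - a) (E (sigma t) (T1_partner n))"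
      using T1_E[OF s, of n] False by (simp add: t a_def x_def xspec_eq)
    then have "pairing t p (T1 (sigma t) (E (sigma t) n)) =
        a * poly p (- x) + (t1 - a) * poly p x"
      by (simp add: pairing_add pairing_smult pairing_E[OF assms] x flip: x_def)
    moreover have "poly (T1 t p) (- x) = a * poly p (- x) + (t1 - a) * poly p x"
      unfolding t using x(1) by (simp add: poly_T1 a_def) (simp add: field_simps power2_eq_square)
    ultimately show ?thesis
      by (simp add: pairing_E[OF assms] flip: x_def)
  qed
qed (simp_all add: T1_add T1_smult)

text \<open>The comparison made for \<open>T1\<close>, with \<open>x + 1\<close>, the reflection of
  \<open>- x\<close> in \<open>1/2\<close>, as the neighbouring dual point.\<close>

lemma pairing_T0:
  assumes "regular t"
  shows "pairing t (T0 t p) q = pairing t p (S (sigma t) q)"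
proof (rule pairing_eqI[OF assms])
  fix n
  obtain t0 u0 t1 u1 where t: "t = (t0, u0, t1, u1)"
    by (cases t)
  have s: "regular (u1, u0, t1, t0)"
    using assms regular_sigma[of t] by (simp add: t)
  define x where "x = xspec t n"
  define a where "a = (u0\<^sup>2 - t0\<^sup>2 - (x + 1/2)\<^sup>2) / (2 * x + 1)"
  have x: "2 * x + 1 \<noteq> 0" "xspec t (S_partner n) = - (x + 1)"
    using gamma_neq_half[OF s, of n] gamma_S_partner[of "sigma t" n]
    by (simp_all add: x_def xspec_eq t)
  have "S (sigma t) (E (sigma t) n) =
      smult a (E (sigma t) n) + smult (t0 - a) (E (sigma t) (S_partner n))"
    using S_E[OF s, of n] by (simp add: t a_def x_def xspec_eq)
  then have "pairing t p (S (sigma t) (E (sigma t) n)) =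
      a * poly p (- x) + (t0 - a) * poly p (x + 1)"
    by (simp add: pairing_add pairing_smult pairing_E[OF assms] x(2) add.commute[of 1 x] flip: x_def)
  moreover have "poly (T0 t p) (- x) = a * poly p (- x) + (t0 - a) * poly p (x + 1)"
  proof -
    have "2 * x + 1 = 0" if "- x = 1/2"
    proof -
      have "2 * x + 1 = 1 - 2 * (- x)"
        by simp
      then show ?thesis
        by (simp only: that) simp
    qed
    then have "- x \<noteq> 1/2"
      using x(1) by blast
    moreover have "(t0 + u0 + 1/2 + x) * (t0 - u0 + 1/2 + x) / (1 + 2 * x) = t0 - a"
    proof -
      have "a * (2 * x + 1) = u0\<^sup>2 - t0\<^sup>2 - (x + 1/2)\<^sup>2"
        using x(1) by (simp add: a_def)
      then have "(t0 + u0 + 1/2 + x) * (t0 - u0 + 1/2 + x) = (t0 - a) * (1 + 2 * x)"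
        by (simp add: field_simps power2_eq_square)
      then show ?thesis
        using x(1) by (simp add: add.commute)
    qed
    ultimately show ?thesis
      unfolding t by (simp add: poly_T0) (simp add: algebra_simps)
  qed
  ultimately show "pairing t (T0 t p) (E (sigma t) n) = pairing t p (S (sigma t) (E (sigma t) n))"
    by (simp add: pairing_E[OF assms] flip: x_def)
next
  show "S (sigma t) (f + g) = S (sigma t) f + S (sigma t) g" for f g
    by (simp add: S_def T1_add)
qed (rule S_smult)

text \<open>The two adjoints add up to minus multiplication by \<open>x\<close>. This mirrors
  \<open>pairing_z\<close> and is the source of the symmetry of the form.\<close>

lemma pairing_Y:
  assumes "regular t"
  shows "pairing t (Y t p) q = - pairing t p (pCons 0 q)"
proof -
  have "pairing t (Y t p) q = pairing t p (S (sigma t) q + T1 (sigma t) q)"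
    by (simp add: Y_def pairing_add_left[OF assms] pairing_T0[OF assms] pairing_T1[OF assms] pairing_add)
  also have "S (sigma t) q + T1 (sigma t) q = - pCons 0 q"
    by (simp add: S_def)
  finally show ?thesis
    by (simp only: pairing_uminus)
qed

lemma pairing_S:
  assumes "regular t"
  shows "pairing t (S t p) q = pairing t p (T0 (sigma t) q)"
  unfolding S_def pairing_uminus_left[OF assms] pairing_add_left[OF assms] pairing_z[OF assms]
    pairing_T1[OF assms] by (simp add: Y_def pairing_add pairing_uminus pairing_diff)

text \<open>\<open>pairing_Y\<close> turns every factor \<open>x\<close> of \<open>q\<close> into
  \<open>- gamma t m\<close>; constants contribute through \<open>pairing t (E t m) 1 = 1\<close>,
  the normalization of \<open>E t m\<close>.\<close>

lemma pairing_E_left: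
  assumes "regular t"
  shows "pairing t (E t m) q = poly q (- gamma t m)"
proof -
  obtain t0 u0 t1 u1 where t: "t = (t0, u0, t1, u1)"
    by (cases t)
  have s: "regular (u1, u0, t1, t0)"
    using assms regular_sigma[of t] by (simp add: t)
  show ?thesis
  proof (induction q)
    case 0
    then show ?case
      using pairing_smult[of t "E t m" 0 0] by simp
  next
    case (pCons a q)
    have "E (sigma t) 0 = 1"
      using E_0[OF s] by (simp add: t)
    then have "pairing t (E t m) 1 = poly (E t m) (- xspec t 0)"
      using pairing_E[OF assms, of "E t m" 0] by simp
    also have "\<dots> = 1"
      using poly_E_base assms by (simp add: t xspec_0)
    finally have "pairing t (E t m) 1 = 1" .
    moreover have "pairing t (E t m) (pCons 0 q) = - gamma t m * pairing t (E t m) q"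
      using pairing_Y[OF assms, of "E t m" q] Y_E[of t0 u0 t1 u1 m] assms
      by (simp add: t pairing_smult_left)
    moreover have "pCons a q = smult a 1 + pCons 0 q"
      by simp
    ultimately have "pairing t (E t m) (pCons a q) = a - gamma t m * pairing t (E t m) q"
      by (simp only: pairing_add pairing_smult) simp
    then show ?case
      by (simp add: pCons.IH)
  qed
qed

section \<open>Nondegeneracy and adjoints\<close>

lemma poly_eqI_inj:
  fixes p q :: "complex poly" and x :: "nat \<Rightarrow> complex"
  assumes "inj x" and "\<And>n. poly p (- x n) = poly q (- x n)"
  shows "p = q"
proof (rule poly_eqI_infinite)
  show "infinite (range (\<lambda>n. - x n))"
    using assms(1) by (intro range_inj_infinite) (auto simp: inj_def)
qed (use assms(2) in auto)

lemma inj_gamma: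
  assumes "regular t"
  shows "inj (gamma t)"
  using assms gamma_inj by (cases t) simp

text \<open>The form samples \<open>p\<close> at the infinitely many distinct points
  \<open>- xspec t n\<close>.\<close>

lemma pairing_nondegenerate_left:
  assumes "regular t" "\<And>q. pairing t p q = pairing t p' q"
  shows "p = p'"
proof (rule poly_eqI_inj)
  show "inj (xspec t)"
    unfolding xspec_eq using assms(1) by (intro inj_gamma) (simp add: regular_sigma)
  show "poly p (- xspec t n) = poly p' (- xspec t n)" for n
    using assms(2)[of "E (sigma t) n"] by (simp add: pairing_E[OF assms(1)])
qed

lemma pairing_nondegenerate_right:
  assumes "regular t" "\<And>p. pairing t p q = pairing t p q'"
  shows "q = q'"
proof (rule poly_eqI_inj)
  show "inj (gamma t)"
    using assms(1) by (rule inj_gamma)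
  show "poly q (- gamma t m) = poly q' (- gamma t m)" for m
    using assms(2)[of "E t m"] by (simp add: pairing_E_left[OF assms(1)])
qed

definition adjoint :: "params \<Rightarrow> poly_op \<Rightarrow> poly_op \<Rightarrow> bool" where
  "adjoint t X X' \<longleftrightarrow> (\<forall>p q. pairing t (X p) q = pairing t p (X' q))"

lemma adjoint_unique_right:
  assumes "regular t" "adjoint t X X'" "adjoint t X X''"
  shows "X' = X''"
  using assms unfolding adjoint_def by (intro ext pairing_nondegenerate_right[OF assms(1)]) metis

lemma adjoint_unique_left:
  assumes "regular t" "adjoint t X X''" "adjoint t X' X''"
  shows "X = X'"
  using assms unfolding adjoint_def by (intro ext pairing_nondegenerate_left[OF assms(1)]) metis

lemma S_eq: "S t = (\<lambda>f. - (T1 t f + z_op f))"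
  by (simp add: S_def z_op_def mult_op_def fun_eq_iff)

lemma minus_Y_eq: "(\<lambda>f. - Y t f) = (\<lambda>f. - (T0 t f + T1 t f))"
  by (simp add: Y_def)

context
  fixes t :: params
  assumes t: "regular t"
begin

lemma adjoint_id: "adjoint t id id"
  by (simp add: adjoint_def)

lemma adjoint_T0: "adjoint t (T0 t) (S (sigma t))"
  using pairing_T0[OF t] by (simp add: adjoint_def)

lemma adjoint_T1: "adjoint t (T1 t) (T1 (sigma t))"
  using pairing_T1[OF t] by (simp add: adjoint_def)

lemma adjoint_z: "adjoint t z_op (\<lambda>f. - Y (sigma t) f)"
  using pairing_z[OF t] by (simp add: adjoint_def z_op_def mult_op_def)

lemma adjoint_S: "adjoint t (S t) (T0 (sigma t))"
  using pairing_S[OF t] by (simp add: adjoint_def)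

lemma adjoint_Y: "adjoint t (\<lambda>f. - Y t f) z_op"
  using pairing_Y[OF t] by (simp add: adjoint_def z_op_def mult_op_def pairing_uminus_left[OF t])

lemma adjoint_add:
  "adjoint t X X' \<Longrightarrow> adjoint t Z Z' \<Longrightarrow> adjoint t (\<lambda>f. X f + Z f) (\<lambda>f. X' f + Z' f)"
  by (simp add: adjoint_def pairing_add_left[OF t] pairing_add)

lemma adjoint_smult: "adjoint t X X' \<Longrightarrow> adjoint t (\<lambda>f. smult c (X f)) (\<lambda>f. smult c (X' f))"
  by (simp add: adjoint_def pairing_smult_left[OF t] pairing_smult)

lemma adjoint_comp: "adjoint t X X' \<Longrightarrow> adjoint t Z Z' \<Longrightarrow> adjoint t (X \<circ> Z) (Z' \<circ> X')"
  by (simp add: adjoint_def)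

lemma S_in_H: "S s \<in> H s"
  using H.scale[OF H.add[OF H.T1 H.z], of "-1" s] by (simp add: S_eq)

lemma minus_Y_in_H: "(\<lambda>f. - Y s f) \<in> H s"
  using H.scale[OF H.add[OF H.T0 H.T1], of "-1" s] by (simp add: Y_def)

text \<open>Having an adjoint passes to sums, multiples and products, so the generators
  suffice.\<close>

lemma H_adjoint_right: "X \<in> H t \<Longrightarrow> \<exists>X' \<in> H (sigma t). adjoint t X X'"
proof (induction rule: H.induct)
  case T0
  then show ?case using adjoint_T0 S_in_H by blast
next
  case T1
  then show ?case using adjoint_T1 H.T1 by blast
next
  case z
  then show ?case using adjoint_z minus_Y_in_H by blast
next
  case one
  then show ?case using adjoint_id H.one by blast
next
  case (add X X')
  then show ?case using adjoint_add H.add by blast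
next
  case (scale X c)
  then show ?case using adjoint_smult H.scale by blast
next
  case (comp X X')
  then show ?case using adjoint_comp H.comp by blast
qed

text \<open>Gives surjectivity of taking adjoints: \<open>T0 (sigma t)\<close> and
  \<open>z_op\<close> are reached from \<open>S t\<close> and \<open>- Y t\<close>.\<close>

lemma H_adjoint_left: "X' \<in> H (sigma t) \<Longrightarrow> \<exists>X \<in> H t. adjoint t X X'"
proof (induction rule: H.induct)
  case T0
  then show ?case using adjoint_S S_in_H by blast
next
  case T1
  then show ?case using adjoint_T1 H.T1 by blast
next
  case z
  then show ?case using adjoint_Y minus_Y_in_H by blast
next
  case one
  then show ?case using adjoint_id H.one by blast
next
  case (add X X')
  then show ?case using adjoint_add H.add by blast
next
  case (scale X c)
  then show ?case using adjoint_smult H.scale by blast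
next
  case (comp X X')
  then show ?case using adjoint_comp H.comp by blast
qed

section \<open>Identification of \<open>psi\<close> with the adjoint\<close>

text \<open>By nondegeneracy, taking adjoints is single-valued and injective, hence an
  anti-isomorphism with the prescribed values on generators.\<close>

lemma
  shows psi_in_H: "X \<in> H t \<Longrightarrow> psi t X \<in> H (sigma t)"
    and adjoint_psi: "X \<in> H t \<Longrightarrow> adjoint t X (psi t X)"
    and bij_psi: "bij_betw (psi t) (H t) (H (sigma t))"
proof -
  \<comment> \<open>The choice is unique on \<open>H t\<close>, and \<open>restrict\<close> supplies
    the extensionality demanded in \<open>psi_def\<close>.\<close>
  define \<phi> where "\<phi> = restrict (\<lambda>X. SOME X'. X' \<in> H (sigma t) \<and> adjoint t X X') (H t)"
  have \<phi>: "\<phi> X \<in> H (sigma t)" "adjoint t X (\<phi> X)" if "X \<in> H t" for X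
    using someI_ex[of "\<lambda>X'. X' \<in> H (sigma t) \<and> adjoint t X X'"] H_adjoint_right[OF that] that
    by (auto simp: \<phi>_def)
  have \<phi>_eq: "\<phi> X = X'" if "X \<in> H t" "adjoint t X X'" for X X'
    using adjoint_unique_right[OF t] \<phi>(2) that by blast
  have bij: "bij_betw \<phi> (H t) (H (sigma t))"
    unfolding bij_betw_def
  proof
    show "inj_on \<phi> (H t)"
      using adjoint_unique_left[OF t] \<phi>(2) by (metis inj_onI)
    show "\<phi> ` H t = H (sigma t)"
      using H_adjoint_left \<phi>(1) \<phi>_eq by blast
  qed
  have "psi t = \<phi>"
    unfolding psi_def minus_Y_eq[symmetric] S_eq[symmetric]
  proof (rule the_equality)
    have "alg_anti_iso t (sigma t) \<phi>"
      unfolding alg_anti_iso_def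
      using bij \<phi> adjoint_id adjoint_add adjoint_smult adjoint_comp
      by (intro conjI ballI allI) (auto intro!: \<phi>_eq intro: H.intros)
    then show "\<phi> \<in> extensional (H t) \<and> alg_anti_iso t (sigma t) \<phi> \<and> \<phi> (T0 t) = S (sigma t) \<and>
        \<phi> (T1 t) = T1 (sigma t) \<and> \<phi> z_op = (\<lambda>f. - Y (sigma t) f)"
      using \<phi>_eq adjoint_T0 adjoint_T1 adjoint_z H.T0 H.T1 H.z by (auto simp: \<phi>_def)
  next
    fix \<chi>
    assume \<chi>: "\<chi> \<in> extensional (H t) \<and> alg_anti_iso t (sigma t) \<chi> \<and> \<chi> (T0 t) = S (sigma t) \<and>
        \<chi> (T1 t) = T1 (sigma t) \<and> \<chi> z_op = (\<lambda>f. - Y (sigma t) f)"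
    \<comment> \<open>A competitor yields adjoints on the generators, hence on all of
      \<open>H t\<close> by compatibility with the operations.\<close>
    have "X \<in> H t \<Longrightarrow> adjoint t X (\<chi> X)" for X
    proof (induction rule: H.induct)
      case T0
      then show ?case using adjoint_T0 \<chi> by simp
    next
      case T1
      then show ?case using adjoint_T1 \<chi> by simp
    next
      case z
      then show ?case using adjoint_z \<chi> by simp
    next
      case one
      then show ?case using adjoint_id \<chi> by (simp only: alg_anti_iso_def)
    next
      case (add X X')
      then show ?case using adjoint_add \<chi> by (simp add: alg_anti_iso_def)
    next
      case (scale X c)
      then show ?case using adjoint_smult \<chi> by (simp add: alg_anti_iso_def)
    next
      case (comp X X')
      then show ?case using adjoint_comp \<chi> by (simp only: alg_anti_iso_def)
    qed
    then have "\<chi> X = \<phi> X" if "X \<in> H t" for X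
      using \<phi>_eq that by metis
    moreover have "\<phi> \<in> extensional (H t)"
      by (simp add: \<phi>_def)
    ultimately show "\<chi> = \<phi>"
      using \<chi> extensionalityI by blast
  qed
  then show "X \<in> H t \<Longrightarrow> psi t X \<in> H (sigma t)" "X \<in> H t \<Longrightarrow> adjoint t X (psi t X)"
      "bij_betw (psi t) (H t) (H (sigma t))"
    using \<phi> bij by simp_all
qed

lemma adjoint_psi_sigma:
  assumes "X \<in> H (sigma t)"
  shows "adjoint t (psi_sigma t X) X"
proof -
  have "psi_sigma t X \<in> H t"
    unfolding psi_sigma_def
    using bij_betw_the_inv_into[OF bij_psi] assms by (rule bij_betwE[rule_format])
  moreover have "psi t (psi_sigma t X) = X"
    unfolding psi_sigma_def using f_the_inv_into_f_bij_betw[OF bij_psi] assms by blast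
  ultimately show ?thesis
    using adjoint_psi by metis
qed

end

section \<open>Evaluation formulas and duality\<close>

lemma mult_op_in_H: "mult_op q \<in> H t"
proof (induction q)
  case 0
  have "mult_op 0 = (\<lambda>f. smult 0 (id f))"
    by (simp add: mult_op_def)
  then show ?case
    using H.scale[OF H.one] by metis
next
  case (pCons a q)
  have "mult_op (pCons a q) = (\<lambda>f. smult a (id f) + (z_op \<circ> mult_op q) f)"
    by (simp add: mult_op_def z_op_def fun_eq_iff)
  moreover have "(\<lambda>f. smult a (id f) + (z_op \<circ> mult_op q) f) \<in> H t"
    using pCons.IH by (intro H.add H.comp H.scale H.one H.z)
  ultimately show ?case
    by metis
qed

theorem theorem3p16:
  fixes t :: params and m n :: nat and p :: "complex poly"
  assumes "generic t"
  shows "poly p (- gamma t m) = B_tilde t (mult_op p) (mult_op (E t m)) \<and>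
         poly p (- xspec t n) = B t (mult_op p) (mult_op (E (sigma t) n)) \<and>
         poly (E t m) (- xspec t n) = poly (E (sigma t) n) (- gamma t m)"
proof (intro conjI)
  have t: "regular t" and s: "regular (sigma t)"
    using assms generic_imp_regular by (simp_all add: regular_sigma)
  have E_0: "E t 0 = 1" "E (sigma t) 0 = 1"
    using E_0 t s by (metis prod_cases4)+
  \<comment> \<open>Evaluation at \<open>- gamma t 0\<close> is pairing with
    \<open>E t 0 = 1\<close> on the left.\<close>
  have "B_tilde t (mult_op p) (mult_op (E t m)) = pairing t (E t 0) (psi t (mult_op (E t m)) p)"
    by (simp add: B_tilde_def Ev_tilde_def pairing_E_left[OF t] mult_op_def)
  also have "\<dots> = pairing t (mult_op (E t m) 1) p"
    using adjoint_psi[OF t mult_op_in_H] by (simp add: adjoint_def E_0)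
  also have "\<dots> = poly p (- gamma t m)"
    by (simp add: mult_op_def pairing_E_left[OF t])
  finally show "poly p (- gamma t m) = B_tilde t (mult_op p) (mult_op (E t m))" ..
  \<comment> \<open>Evaluation at \<open>- xspec t 0\<close> is pairing with
    \<open>E (sigma t) 0 = 1\<close> on the right.\<close>
  have "B t (mult_op p) (mult_op (E (sigma t) n)) =
      pairing t (psi_sigma t (mult_op (E (sigma t) n)) p) (E (sigma t) 0)"
    by (simp add: B_def Ev_def pairing_E[OF t] mult_op_def)
  also have "\<dots> = pairing t p (mult_op (E (sigma t) n) 1)"
    using adjoint_psi_sigma[OF t mult_op_in_H] by (simp add: adjoint_def E_0)
  also have "\<dots> = poly p (- xspec t n)"
    by (simp add: mult_op_def pairing_E[OF t])
  finally show "poly p (- xspec t n) = B t (mult_op p) (mult_op (E (sigma t) n))" ..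
  \<comment> \<open>Both values are the pairing of \<open>E t m\<close> with
    \<open>E (sigma t) n\<close>.\<close>
  show "poly (E t m) (- xspec t n) = poly (E (sigma t) n) (- gamma t m)"
    using pairing_E[OF t, of "E t m" n] pairing_E_left[OF t, of m "E (sigma t) n"] by simp
qed

end
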